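(* Let $\Gamma$ be an infinite finitely generated discrete group with the rapid decay property with decay exponent $r>0$, equipped with a word length function $\ell$. For any natural number $k>r$, if $\mathrm{Mdim}_{L^k_\ell}(C^*_r(\Gamma))=d<+\infty$, then for any automorphism $\phi$ of $\Gamma$, $$\mathrm{Entp}(\phi)\le k\,d\,h_{\mathrm{geo}}(\phi).$$
   Context: $\ell$ is the word length function with respect to a fixed finite generating set. $\Gamma$ has the rapid decay property with decay exponent $r>0$ (with respect to $\ell$) if there is $C>0$ such that $\|f\|_{\mathrm{red}}\le C\big(\sum_{g\in\Gamma}|f(g)|^2(1+\ell(g))^{2r}\big)^{1/2}$ for all $f\in C_c(\Gamma)$. $C^*_r(\Gamma)$ is the reduced group $C^*$-algebra with norm $\|\cdot\|_{\mathrm{red}}$, $\lambda$ is its (left regular) representation on $\ell^2(\Gamma)$, $C_c(\Gamma)$ is the dense $*$-subalgebra of finitely supported functions $\sum c_g\delta_g$ (with convolution product), and $C_c(\Gamma)_1=\{f\in C_c(\Gamma):\|f\|_{\mathrm{red}}\le1\}$. $M_\ell$ is the unbounded operator on $\ell^2(\Gamma)$ with domain $C_c(\Gamma)$, $M_\ell(\sum c_g\delta_g)=\sum\ell(g)c_g\delta_g$. For $f\in C_c(\Gamma)$, $\Delta^1_\ell(f)=[M_\ell,\lambda(f)]$ and $\Delta^k_\ell(f)=[M_\ell,\Delta^{k-1}_\ell(f)]$; these extend to bounded operators. The seminorm $L^k_\ell:C^*_r(\Gamma)\to[0,+\infty]$ is $L^k_\ell(f)=\|\Delta^k_\ell(f)\|_{\mathrm{op}}$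 for $f\in C_c(\Gamma)$ and $+\infty$ off $C_c(\Gamma)$. (For $k>r$ the pair $(C^*_r(\Gamma),L^k_\ell)$ is a compact quantum metric space, by a known theorem of Antonescu and Christensen.) For a subset $Y$ of a normed space $X$ and $\delta>0$, $D(Y,\delta)$ is the infimum of $\dim Z$ over finite-dimensional subspaces $Z\subseteq X$ such that for every $y\in Y$ there is $z\in Z$ with $\|y-z\|<\delta$. The metric dimension is $\mathrm{Mdim}_{L}(A)=\limsup_{\delta\to0^+}\frac{\log D(\mathcal L_1,\delta)}{\log\delta^{-1}}$, where $\mathcal L_1=\{a\in A:L(a)<1\}$. An automorphism $\phi$ of $\Gamma$ induces an automorphism of $C^*_r(\Gamma)$, also denoted $\phi$, with $\phi(\sum c_g\delta_g)=\sum c_g\delta_{\phi(g)}$. Product entropy: for finite $\Omega\subseteq C_c(\Gamma)_1$ and $\delta>0$, $\mathrm{Entp}(\phi,\Omega,\delta)=\limsup_{n\to\infty}\frac1n\log D\big(\Omega\,\phi(\Omega)\cdots\phi^{n-1}(\Omega),\delta\big)$ (set of all products $a_0\cdots a_{n-1}$, $a_i\in\phi^i(\Omega)$, in $C_r^*(\Gamma)$), and $\mathrm{Entp}(\phi)=\sup_{\Omega}\sup_{\delta>0}\mathrm{Entp}(\phi,\Omega,\delta)$, with $\Omega$ ranging over finite subsets of $C_c(\Gamma)_1$. Geometric entropy: $h_{\mathrm{geo}}(\phi)=\log\big(\sup_{g\in\Gamma}\limsup_{n\to\infty}\ell(\phi^n(g))^{1/n}\big)$. *)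

theory Defs
  imports "HOL-Analysis.Analysis" "HOL-Library.Poly_Mapping"
begin

text \<open>
  The group \<open>\<Gamma>\<close> is a type of class \<^class>\<open>group_add\<close>, which is not assumed commutative; the group
  law is therefore written additively. The group algebra \<open>C\<^sub>c(\<Gamma>)\<close> is the type
  \<open>'g \<Rightarrow>\<^sub>0 complex\<close> of finitely supported functions, whose multiplication is convolution and
  in which \<open>Poly_Mapping.single g 1\<close> is \<open>\<delta>\<^sub>g\<close>.
\<close>

section \<open>The space \<open>\<ell>\<^sup>2\<close>\<close>

typedef 'a ell2 = "{x :: 'a \<Rightarrow> complex. (\<lambda>g. (cmod (x g))\<^sup>2) summable_on UNIV}"
  morphisms ell2_fun Abs_ell2
  by (rule exI[of _ "\<lambda>_. 0"]) simp

setup_lifting type_definition_ell2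

lemma ell2_summable: "(\<lambda>g. (cmod (ell2_fun x g))\<^sup>2) summable_on UNIV"
  using ell2_fun by blast

lemma ell2_eqI: "(\<And>g. ell2_fun x g = ell2_fun y g) \<Longrightarrow> x = y"
  by (simp add: ell2_fun_inject[symmetric] fun_eq_iff)

lemma square_summable_add:
  fixes x y :: "'a \<Rightarrow> complex"
  assumes "(\<lambda>g. (cmod (x g))\<^sup>2) summable_on UNIV" "(\<lambda>g. (cmod (y g))\<^sup>2) summable_on UNIV"
  shows "(\<lambda>g. (cmod (x g + y g))\<^sup>2) summable_on UNIV"
proof (rule summable_on_comparison_test)
  show "(\<lambda>g. 2 * ((cmod (x g))\<^sup>2 + (cmod (y g))\<^sup>2)) summable_on UNIV"
    by (intro summable_on_cmult_right summable_on_add assms)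
  fix g :: 'a
  have "(cmod (x g + y g))\<^sup>2 \<le> (cmod (x g) + cmod (y g))\<^sup>2"
    by (intro power_mono norm_triangle_ineq) simp
  also have "\<dots> \<le> 2 * ((cmod (x g))\<^sup>2 + (cmod (y g))\<^sup>2)"
    using sum_squares_bound[of "cmod (x g)" "cmod (y g)"] by (simp add: power2_sum)
  finally show "(cmod (x g + y g))\<^sup>2 \<le> 2 * ((cmod (x g))\<^sup>2 + (cmod (y g))\<^sup>2)" .
qed simp

lemma square_summable_mult:
  fixes x :: "'a \<Rightarrow> complex"
  assumes "(\<lambda>g. (cmod (x g))\<^sup>2) summable_on UNIV"
  shows "(\<lambda>g. (cmod (c * x g))\<^sup>2) summable_on UNIV"
  using summable_on_cmult_right[OF assms, of "(cmod c)\<^sup>2"] by (simp add: norm_mult power_mult_distrib)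

lemma square_summable_inner:
  fixes x y :: "'a \<Rightarrow> complex"
  assumes "(\<lambda>g. (cmod (x g))\<^sup>2) summable_on UNIV" "(\<lambda>g. (cmod (y g))\<^sup>2) summable_on UNIV"
  shows "(\<lambda>g. x g \<bullet> y g) summable_on UNIV"
proof -
  have eq: "x g \<bullet> y g = (1/2) * ((cmod (x g + y g))\<^sup>2 + (-1) * ((cmod (x g))\<^sup>2 + (cmod (y g))\<^sup>2))" for g
    by (simp add: power2_norm_eq_inner inner_add_left inner_add_right inner_commute)
  show ?thesis unfolding eq
    by (intro summable_on_cmult_right summable_on_add square_summable_add assms)
qed

lemma square_summable_fin_supp:
  fixes x :: "'a \<Rightarrow> complex"
  assumes "finite {h. x h \<noteq> 0}"
  shows "(\<lambda>g. (cmod (x g))\<^sup>2) summable_on UNIV"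
proof -
  have "(\<lambda>g. (cmod (x g))\<^sup>2) summable_on {h. x h \<noteq> 0}"
    by (rule summable_on_finite[OF assms])
  also have "?this \<longleftrightarrow> (\<lambda>g. (cmod (x g))\<^sup>2) summable_on UNIV"
    by (rule summable_on_cong_neutral) auto
  finally show ?thesis .
qed

instantiation ell2 :: (type) real_vector
begin

lift_definition zero_ell2 :: "'a ell2" is "\<lambda>_. 0" by simp

lift_definition plus_ell2 :: "'a ell2 \<Rightarrow> 'a ell2 \<Rightarrow> 'a ell2" is "\<lambda>x y g. x g + y g"
  by (simp add: square_summable_add)

lift_definition uminus_ell2 :: "'a ell2 \<Rightarrow> 'a ell2" is "\<lambda>x g. - x g" by simp

lift_definition minus_ell2 :: "'a ell2 \<Rightarrow> 'a ell2 \<Rightarrow> 'a ell2" is "\<lambda>x y g. x g - y g"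
  using square_summable_add[where y = "\<lambda>g. - y g" for y] by fastforce

lift_definition scaleR_ell2 :: "real \<Rightarrow> 'a ell2 \<Rightarrow> 'a ell2" is "\<lambda>r x g. complex_of_real r * x g"
  by (simp only: mem_Collect_eq square_summable_mult)

instance
  by standard (rule ell2_eqI; simp add: plus_ell2.rep_eq zero_ell2.rep_eq uminus_ell2.rep_eq
      minus_ell2.rep_eq scaleR_ell2.rep_eq algebra_simps)+

end

instantiation ell2 :: (type) real_inner
begin

definition norm_ell2 :: "'a ell2 \<Rightarrow> real"
  where "norm_ell2 x = sqrt (\<Sum>\<^sub>\<infinity>g. (cmod (ell2_fun x g))\<^sup>2)"

text \<open>The real part of the complex inner product of \<open>\<ell>\<^sup>2\<close>, as \<^class>\<open>real_inner\<close> requires.\<close>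

definition inner_ell2 :: "'a ell2 \<Rightarrow> 'a ell2 \<Rightarrow> real"
  where "inner_ell2 x y = (\<Sum>\<^sub>\<infinity>g. ell2_fun x g \<bullet> ell2_fun y g)"

definition dist_ell2 :: "'a ell2 \<Rightarrow> 'a ell2 \<Rightarrow> real"
  where "dist_ell2 x y = norm (x - y)"

definition sgn_ell2 :: "'a ell2 \<Rightarrow> 'a ell2"
  where "sgn_ell2 x = x /\<^sub>R norm x"

definition uniformity_ell2 :: "('a ell2 \<times> 'a ell2) filter"
  where "uniformity_ell2 = (INF e\<in>{0<..}. principal {(x, y). dist x y < e})"

definition open_ell2 :: "'a ell2 set \<Rightarrow> bool"
  where "open_ell2 U = (\<forall>x\<in>U. \<forall>\<^sub>F (x', y) in uniformity. x' = x \<longrightarrow> y \<in> U)"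

instance
proof
  note summ = square_summable_inner[OF ell2_summable ell2_summable]
  fix x y z :: "'a ell2" and r :: real
  show "inner x y = inner y x"
    by (simp add: inner_ell2_def inner_commute)
  show "inner (x + y) z = inner x z + inner y z"
    by (simp add: inner_ell2_def plus_ell2.rep_eq inner_add_left infsum_add summ)
  show "inner (scaleR r x) y = r * inner x y"
    by (simp add: inner_ell2_def scaleR_ell2.rep_eq infsum_cmult_right[OF summ, symmetric]
        flip: scaleR_conv_of_real)
  show "0 \<le> inner x x"
    by (simp add: inner_ell2_def infsum_nonneg)
  show "inner x x = 0 \<longleftrightarrow> x = 0"
  proof
    assume "inner x x = 0"
    hence "ell2_fun x g \<bullet> ell2_fun x g = 0" for g
      by (intro nonneg_infsum_le_0D[of "\<lambda>g. ell2_fun x g \<bullet> ell2_fun x g" UNIV])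
        (auto simp: inner_ell2_def summ)
    thus "x = 0" by (auto intro!: ell2_eqI simp: zero_ell2.rep_eq)
  qed (simp add: inner_ell2_def zero_ell2.rep_eq)
  show "norm x = sqrt (inner x x)"
    by (simp add: inner_ell2_def norm_ell2_def power2_norm_eq_inner)
qed (simp_all add: dist_ell2_def sgn_ell2_def uniformity_ell2_def open_ell2_def)

end

lemma norm_ell2_square: "(norm x)\<^sup>2 = (\<Sum>\<^sub>\<infinity>g. (cmod (ell2_fun x g))\<^sup>2)"
  by (simp add: norm_ell2_def infsum_nonneg)


section \<open>The complex vector space of bounded operators on \<open>\<ell>\<^sup>2\<close>\<close>

type_synonym 'a bop = "'a ell2 \<Rightarrow>\<^sub>L 'a ell2"

lift_definition scaleC_ell2 :: "complex \<Rightarrow> 'a ell2 \<Rightarrow> 'a ell2" is "\<lambda>c x g. c * x g"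
  by (simp only: mem_Collect_eq square_summable_mult)

lemma norm_scaleC_ell2: "norm (scaleC_ell2 c x) = cmod c * norm x"
  by (simp add: norm_ell2_def scaleC_ell2.rep_eq norm_mult power_mult_distrib
      infsum_cmult_right[OF ell2_summable] real_sqrt_mult)

lemma bounded_linear_scaleC_ell2: "bounded_linear (scaleC_ell2 c :: 'a ell2 \<Rightarrow> 'a ell2)"
proof (rule bounded_linear_intro[where K = "cmod c"])
  show "scaleC_ell2 c (x + y) = scaleC_ell2 c x + scaleC_ell2 c y" for x y :: "'a ell2"
    by (rule ell2_eqI) (simp add: plus_ell2.rep_eq scaleC_ell2.rep_eq ring_distribs)
  show "scaleC_ell2 c (r *\<^sub>R x) = r *\<^sub>R scaleC_ell2 c x" for r and x :: "'a ell2"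
    by (rule ell2_eqI) (simp add: scaleR_ell2.rep_eq scaleC_ell2.rep_eq)
qed (simp add: norm_scaleC_ell2)

definition scaleC_bop :: "complex \<Rightarrow> 'a bop \<Rightarrow> 'a bop"
  where "scaleC_bop c T = Blinfun (scaleC_ell2 c) o\<^sub>L T"

lemma scaleC_bop_apply: "blinfun_apply (scaleC_bop c T) x = scaleC_ell2 c (blinfun_apply T x)"
  by (simp add: scaleC_bop_def bounded_linear_Blinfun_apply bounded_linear_scaleC_ell2)

lemma vector_space_bop: "vector_space (scaleC_bop :: complex \<Rightarrow> 'a bop \<Rightarrow> 'a bop)"
  by standard (rule blinfun_eqI, rule ell2_eqI, simp add: scaleC_bop_apply scaleC_ell2.rep_eq
      plus_ell2.rep_eq blinfun.add_left blinfun.add_right ring_distribs)+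


section \<open>The reduced group algebra\<close>

lemma summable_translate:
  fixes x :: "'g::group_add \<Rightarrow> complex"
  shows "(\<lambda>h. (cmod (x (- g + h)))\<^sup>2) summable_on UNIV \<longleftrightarrow> (\<lambda>h. (cmod (x h))\<^sup>2) summable_on UNIV"
  by (rule summable_on_reindex_bij_witness[where i = "\<lambda>h. g + h" and j = "\<lambda>h. - g + h"])
    (auto simp: add.assoc[symmetric])

lift_definition translate_ell2 :: "'g::group_add \<Rightarrow> 'g ell2 \<Rightarrow> 'g ell2" is "\<lambda>g x h. x (- g + h)"
  by (simp add: summable_translate)

lemma norm_translate_ell2: "norm (translate_ell2 g x) = norm x"
proof -
  have "(\<Sum>\<^sub>\<infinity>h. (cmod (ell2_fun x (- g + h)))\<^sup>2) = (\<Sum>\<^sub>\<infinity>h. (cmod (ell2_fun x h))\<^sup>2)"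
    by (rule infsum_reindex_bij_witness[where i = "\<lambda>h. g + h" and j = "\<lambda>h. - g + h"])
      (auto simp: add.assoc[symmetric])
  thus ?thesis by (simp add: norm_ell2_def translate_ell2.rep_eq)
qed

lemma bounded_linear_translate_ell2: "bounded_linear (translate_ell2 g)"
  by (rule bounded_linear_intro[where K = 1])
    (auto intro!: ell2_eqI simp: norm_translate_ell2 plus_ell2.rep_eq scaleR_ell2.rep_eq
      translate_ell2.rep_eq)

definition translate :: "'g::group_add \<Rightarrow> 'g bop"
  where "translate g = Blinfun (translate_ell2 g)"

lemma translate_apply: "blinfun_apply (translate g) x = translate_ell2 g x"
  by (simp add: translate_def bounded_linear_Blinfun_apply bounded_linear_translate_ell2)

definition lam :: "('g::group_add \<Rightarrow>\<^sub>0 complex) \<Rightarrow> 'g bop"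
  where "lam f = (\<Sum>g\<in>Poly_Mapping.keys f. scaleC_bop (Poly_Mapping.lookup f g) (translate g))"

lemma ell2_fun_sum: "ell2_fun (\<Sum>i\<in>A. x i) h = (\<Sum>i\<in>A. ell2_fun (x i) h)"
  by (induction A rule: infinite_finite_induct) (auto simp: zero_ell2.rep_eq plus_ell2.rep_eq)

lemma lam_apply:
  "ell2_fun (blinfun_apply (lam f) x) h =
     (\<Sum>g\<in>Poly_Mapping.keys f. Poly_Mapping.lookup f g * ell2_fun x (- g + h))"
  by (simp add: lam_def blinfun.sum_left ell2_fun_sum scaleC_bop_apply scaleC_ell2.rep_eq
      translate_apply translate_ell2.rep_eq)

definition norm_red :: "('g::group_add \<Rightarrow>\<^sub>0 complex) \<Rightarrow> real"
  where "norm_red f = norm (lam f)"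

definition Cstar_red :: "'g::group_add bop set"
  where "Cstar_red = closure (range lam)"


section \<open>Word length and rapid decay\<close>

definition is_word :: "'g::group_add set \<Rightarrow> 'g list \<Rightarrow> bool"
  where "is_word S ws \<longleftrightarrow> set ws \<subseteq> S \<union> uminus ` S"

definition generates :: "'g::group_add set \<Rightarrow> bool"
  where "generates S \<longleftrightarrow> (\<forall>g. \<exists>ws. is_word S ws \<and> sum_list ws = g)"

definition word_length :: "'g::group_add set \<Rightarrow> 'g \<Rightarrow> nat"
  where "word_length S g = (LEAST n. \<exists>ws. is_word S ws \<and> sum_list ws = g \<and> length ws = n)"

definition rapid_decay :: "('g::group_add \<Rightarrow> nat) \<Rightarrow> real \<Rightarrow> bool"
  where "rapid_decay l r \<longleftrightarrow>
    (\<exists>C>0. \<forall>f. norm_red f \<le>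
      C * sqrt (\<Sum>g\<in>Poly_Mapping.keys f.
                 (cmod (Poly_Mapping.lookup f g))\<^sup>2 * (1 + real (l g)) powr (2 * r)))"


section \<open>The seminorms \<open>L\<^sup>k\<close>\<close>

definition fin_supp :: "'a ell2 set"
  where "fin_supp = {x. finite {g. ell2_fun x g \<noteq> 0}}"

text \<open>
  The unbounded operator \<open>M\<close> has domain \<^const>\<open>fin_supp\<close>. It is encoded as a total function that
  vanishes off this domain; the lemma \<open>commutators_fin_supp\<close> below shows that the iterated
  commutators, evaluated on \<^const>\<open>fin_supp\<close>, never leave it.
\<close>

lift_definition mult_length :: "('g \<Rightarrow> nat) \<Rightarrow> 'g ell2 \<Rightarrow> 'g ell2"
  is "\<lambda>l x g. if finite {h. x h \<noteq> 0} then of_nat (l g) * x g else 0"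
proof goal_cases
  case (1 l x)
  show ?case
  proof (cases "finite {h. x h \<noteq> 0}")
    case True
    hence "finite {h. of_nat (l h) * x h \<noteq> 0}"
      by (rule rev_finite_subset) auto
    from square_summable_fin_supp[OF this] True show ?thesis by simp
  qed simp
qed

fun iter_commutator :: "('g::group_add \<Rightarrow> nat) \<Rightarrow> nat \<Rightarrow> 'g bop \<Rightarrow> 'g ell2 \<Rightarrow> 'g ell2"
  where
    "iter_commutator l 0 T x = blinfun_apply T x"
  | "iter_commutator l (Suc k) T x =
       mult_length l (iter_commutator l k T x) - iter_commutator l k T (mult_length l x)"

lemma mult_length_fin_supp: "x \<in> fin_supp \<Longrightarrow> mult_length l x \<in> fin_supp"
  by (auto simp: fin_supp_def mult_length.rep_eq elim: rev_finite_subset)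

lemma lam_fin_supp:
  assumes "x \<in> fin_supp" shows "blinfun_apply (lam f) x \<in> fin_supp"
proof -
  have "{h. ell2_fun (blinfun_apply (lam f) x) h \<noteq> 0}
      \<subseteq> (\<lambda>(g, h). g + h) ` (Poly_Mapping.keys f \<times> {h. ell2_fun x h \<noteq> 0})"
  proof
    fix h assume "h \<in> {h. ell2_fun (blinfun_apply (lam f) x) h \<noteq> 0}"
    then obtain g where "g \<in> Poly_Mapping.keys f" "ell2_fun x (- g + h) \<noteq> 0"
      unfolding lam_apply mem_Collect_eq by (metis (no_types, lifting) mult_zero_right sum.neutral)
    thus "h \<in> (\<lambda>(g, h). g + h) ` (Poly_Mapping.keys f \<times> {h. ell2_fun x h \<noteq> 0})"
      by (intro image_eqI[of _ _ "(g, - g + h)"]) (auto simp: add.assoc[symmetric])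
  qed
  thus ?thesis using assms by (auto simp: fin_supp_def intro: finite_subset)
qed

lemma diff_fin_supp: "x \<in> fin_supp \<Longrightarrow> y \<in> fin_supp \<Longrightarrow> x - y \<in> fin_supp"
  unfolding fin_supp_def mem_Collect_eq
  by (rule finite_subset[of _ "{g. ell2_fun x g \<noteq> 0} \<union> {g. ell2_fun y g \<noteq> 0}"])
    (auto simp: minus_ell2.rep_eq)

lemma commutators_fin_supp: "x \<in> fin_supp \<Longrightarrow> iter_commutator l k (lam f) x \<in> fin_supp"
  by (induction k arbitrary: x) (auto intro: lam_fin_supp mult_length_fin_supp diff_fin_supp)

text \<open>
  The norm of an operator defined on the dense subspace \<^const>\<open>fin_supp\<close>, i.e. the norm of its
  bounded extension to \<open>\<ell>\<^sup>2\<close> if there is one (and \<open>\<infinity>\<close> otherwise).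
\<close>

definition dense_opnorm :: "('a ell2 \<Rightarrow> 'a ell2) \<Rightarrow> ereal"
  where "dense_opnorm A = (SUP x\<in>{x \<in> fin_supp. norm x \<le> 1}. ereal (norm (A x)))"

definition Lseminorm :: "('g::group_add \<Rightarrow> nat) \<Rightarrow> nat \<Rightarrow> 'g bop \<Rightarrow> ereal"
  where "Lseminorm l k T =
    (if T \<in> range lam then dense_opnorm (iter_commutator l k T) else \<infinity>)"


section \<open>Metric dimension\<close>

text \<open>
  \<open>scl\<close> is the complex scalar multiplication, \<open>X\<close> the normed space in which the approximating
  subspaces live. The infimum of the empty set in \<^typ>\<open>enat\<close> is \<open>\<infinity>\<close>. Finite dimensionality is
  required separately because \<^const>\<open>vector_space.dim\<close> is \<open>0\<close> on infinite-dimensional subspaces.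
\<close>

definition approx_dim ::
    "(complex \<Rightarrow> 'b::real_normed_vector \<Rightarrow> 'b) \<Rightarrow> 'b set \<Rightarrow> 'b set \<Rightarrow> real \<Rightarrow> enat"
  where "approx_dim scl X Y \<delta> =
    Inf {enat (vector_space.dim scl Z) | Z.
           Z \<subseteq> X \<and> module.subspace scl Z \<and> (\<exists>B. finite B \<and> module.span scl B = Z) \<and>
           (\<forall>y\<in>Y. \<exists>z\<in>Z. norm (y - z) < \<delta>)}"

definition eln :: "ereal \<Rightarrow> ereal"
  where "eln x = (if x \<le> 0 then -\<infinity> else if x = \<infinity> then \<infinity> else ereal (ln (real_of_ereal x)))"

definition Mdim ::
    "(complex \<Rightarrow> 'b::real_normed_vector \<Rightarrow> 'b) \<Rightarrow> ('b \<Rightarrow> ereal) \<Rightarrow> 'b set \<Rightarrow> ereal"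
  where "Mdim scl L A =
    Limsup (at_right 0)
      (\<lambda>\<delta>. eln (ereal_of_enat (approx_dim scl A {a \<in> A. L a < 1} \<delta>)) / ereal (ln (1 / \<delta>)))"


section \<open>Automorphisms and entropies\<close>

definition group_automorphism :: "('g::group_add \<Rightarrow> 'g) \<Rightarrow> bool"
  where "group_automorphism \<phi> \<longleftrightarrow> bij \<phi> \<and> (\<forall>g h. \<phi> (g + h) = \<phi> g + \<phi> h)"

definition induced :: "('g \<Rightarrow> 'g) \<Rightarrow> ('g \<Rightarrow>\<^sub>0 complex) \<Rightarrow> ('g \<Rightarrow>\<^sub>0 complex)"
  where "induced \<phi> f =
    (\<Sum>g\<in>Poly_Mapping.keys f. Poly_Mapping.single (\<phi> g) (Poly_Mapping.lookup f g))"

definition orbit_products ::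
    "('g::group_add \<Rightarrow> 'g) \<Rightarrow> ('g \<Rightarrow>\<^sub>0 complex) set \<Rightarrow> nat \<Rightarrow> ('g \<Rightarrow>\<^sub>0 complex) set"
  where "orbit_products \<phi> \<Omega> n =
    {prod_list (map a [0..<n]) | a. \<forall>i<n. a i \<in> (induced \<phi> ^^ i) ` \<Omega>}"

definition Entp_at :: "('g::group_add \<Rightarrow> 'g) \<Rightarrow> ('g \<Rightarrow>\<^sub>0 complex) set \<Rightarrow> real \<Rightarrow> ereal"
  where "Entp_at \<phi> \<Omega> \<delta> =
    limsup (\<lambda>n. eln (ereal_of_enat (approx_dim scaleC_bop Cstar_red (lam ` orbit_products \<phi> \<Omega> n) \<delta>))
                / ereal (real n))"

definition Entp :: "('g::group_add \<Rightarrow> 'g) \<Rightarrow> ereal"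
  where "Entp \<phi> =
    (SUP \<Omega>\<in>{\<Omega>. finite \<Omega> \<and> (\<forall>f\<in>\<Omega>. norm_red f \<le> 1)}. SUP \<delta>\<in>{0<..}. Entp_at \<phi> \<Omega> \<delta>)"

definition h_geo :: "('g \<Rightarrow> nat) \<Rightarrow> ('g \<Rightarrow> 'g) \<Rightarrow> ereal"
  where "h_geo l \<phi> = eln (SUP g. limsup (\<lambda>n. ereal (root n (real (l ((\<phi> ^^ n) g))))))"

end

theory Submission
  imports Defs
begin

text \<open>
  A product \<open>b\<close> of \<open>n\<close> factors \<open>a\<^sub>i \<in> \<phi>\<^sup>i(\<Omega>)\<close> satisfies \<open>\<parallel>\<Delta>\<^sup>j(b)\<parallel> \<le> R\<^sub>n\<^sup>j\<close> for all \<open>j\<close>,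
  where \<open>R\<^sub>n\<close> is, up to a constant, the sum over \<open>i < n\<close> of the maximal word lengths in the
  supports of the \<open>a\<^sub>i\<close>: such bounds add up under products by the Leibniz rule. For every
  \<open>q > exp h\<^sub>g\<^sub>e\<^sub>o(\<phi>)\<close> one has \<open>R\<^sub>n \<le> B q\<^sup>n\<close>, so \<open>b\<close> scaled by \<open>1 / (2 (B q\<^sup>n)\<^sup>k)\<close> lies in the set
  \<open>{a. L\<^sup>k(a) < 1}\<close>. Hence the products are approximated up to \<open>\<delta>\<close> in the dimension needed to
  approximate that set up to \<open>\<delta> / (2 (B q\<^sup>n)\<^sup>k)\<close>. Its logarithm is at most
  \<open>d' (n k ln q + O(1))\<close> for every \<open>d' > d\<close>, and \<open>d' \<rightarrow> d\<close>, \<open>ln q \<rightarrow> h\<^sub>g\<^sub>e\<^sub>o(\<phi>)\<close> give the claim.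
\<close>

section \<open>Sums over the support of a finitely supported function\<close>

lemma poly_mapping_sum_monomials:
  fixes f :: "'g \<Rightarrow>\<^sub>0 complex"
  shows "(\<Sum>g\<in>Poly_Mapping.keys f. Poly_Mapping.single g (Poly_Mapping.lookup f g)) = f"
  by (rule poly_mapping_eqI)
    (simp add: lookup_sum lookup_single when_def in_keys_iff sum.delta)

text \<open>Sums of this shape are values at \<open>f\<close> of the linear functional sending the
  point mass at \<open>p\<close> to \<open>K p\<close>. Cancellation can make the support of a sum
  smaller than the union of the supports; a common finite \<open>A\<close> removes this obstacle to
  additivity.\<close>

lemma sum_keys_superset:
  fixes f :: "'g \<Rightarrow>\<^sub>0 complex"
  assumes "finite A" "Poly_Mapping.keys f \<subseteq> A"
  shows "(\<Sum>p\<in>Poly_Mapping.keys f. Poly_Mapping.lookup f p * K p)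
       = (\<Sum>p\<in>A. Poly_Mapping.lookup f p * K p)"
  using assms by (intro sum.mono_neutral_left) (auto simp: in_keys_iff)

lemma sum_keys_add:
  fixes a b :: "'g \<Rightarrow>\<^sub>0 complex"
  shows "(\<Sum>p\<in>Poly_Mapping.keys (a + b). Poly_Mapping.lookup (a + b) p * K p)
       = (\<Sum>p\<in>Poly_Mapping.keys a. Poly_Mapping.lookup a p * K p)
       + (\<Sum>p\<in>Poly_Mapping.keys b. Poly_Mapping.lookup b p * K p)"
proof -
  let ?A = "Poly_Mapping.keys a \<union> Poly_Mapping.keys b"
  note sup = sum_keys_superset[of ?A]
  show ?thesis
    using sup[of "a + b"] sup[of a] sup[of b] Poly_Mapping.keys_add[of a b]
    by (simp add: lookup_add ring_distribs sum.distrib)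
qed

lemma sum_keys_sum:
  fixes a :: "'i \<Rightarrow> 'g \<Rightarrow>\<^sub>0 complex"
  assumes "finite I"
  shows "(\<Sum>p\<in>Poly_Mapping.keys (\<Sum>i\<in>I. a i). Poly_Mapping.lookup (\<Sum>i\<in>I. a i) p * K p)
       = (\<Sum>i\<in>I. \<Sum>p\<in>Poly_Mapping.keys (a i). Poly_Mapping.lookup (a i) p * K p)"
  using assms by induction (simp_all add: sum_keys_add)

lemma sum_keys_single:
  fixes c :: complex
  shows "(\<Sum>p\<in>Poly_Mapping.keys (Poly_Mapping.single g c).
            Poly_Mapping.lookup (Poly_Mapping.single g c) p * K p) = c * K g"
  by simp

text \<open>By linearity both factors may be expanded into monomials, so cancellation in
  \<open>a * b\<close> never has to be tracked.\<close>

lemma sum_keys_mult: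
  fixes a b :: "'g::monoid_add \<Rightarrow>\<^sub>0 complex"
  shows "(\<Sum>p\<in>Poly_Mapping.keys (a * b). Poly_Mapping.lookup (a * b) p * K p)
       = (\<Sum>g\<in>Poly_Mapping.keys a. \<Sum>h\<in>Poly_Mapping.keys b.
            Poly_Mapping.lookup a g * Poly_Mapping.lookup b h * K (g + h))"
proof -
  have "a * b = (\<Sum>g\<in>Poly_Mapping.keys a. Poly_Mapping.single g (Poly_Mapping.lookup a g))
              * (\<Sum>h\<in>Poly_Mapping.keys b. Poly_Mapping.single h (Poly_Mapping.lookup b h))"
    by (simp add: poly_mapping_sum_monomials)
  also have "\<dots> = (\<Sum>g\<in>Poly_Mapping.keys a. \<Sum>h\<in>Poly_Mapping.keys b.
      Poly_Mapping.single (g + h) (Poly_Mapping.lookup a g * Poly_Mapping.lookup b h))"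
    by (simp add: sum_product mult_single)
  finally show ?thesis
    by (simp only: sum_keys_sum finite_keys sum_keys_single)
qed

lemma lookup_induced:
  assumes "inj \<psi>"
  shows "Poly_Mapping.lookup (induced \<psi> f) (\<psi> g) = Poly_Mapping.lookup f g"
proof -
  have "Poly_Mapping.lookup (induced \<psi> f) (\<psi> g)
      = (\<Sum>h\<in>Poly_Mapping.keys f. if h = g then Poly_Mapping.lookup f h else 0)"
    unfolding induced_def lookup_sum
    by (rule sum.cong) (auto simp: lookup_single when_def inj_eq[OF assms])
  thus ?thesis by (simp add: sum.delta in_keys_iff)
qed

lemma keys_induced:
  assumes "inj \<psi>"
  shows "Poly_Mapping.keys (induced \<psi> f) = \<psi> ` Poly_Mapping.keys f"
proof
  show "Poly_Mapping.keys (induced \<psi> f) \<subseteq> \<psi> ` Poly_Mapping.keys f"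
    unfolding induced_def
    by (rule order_trans[OF Poly_Mapping.keys_sum]) (auto split: if_splits)
  show "\<psi> ` Poly_Mapping.keys f \<subseteq> Poly_Mapping.keys (induced \<psi> f)"
    by (auto simp: in_keys_iff lookup_induced[OF assms])
qed

text \<open>Injectivity moves coefficients without merging any, so the summand may depend on them
  nonlinearly, for instance through \<open>cmod\<close>.\<close>

lemma sum_keys_induced:
  assumes "inj \<psi>"
  shows "(\<Sum>p\<in>Poly_Mapping.keys (induced \<psi> f). F p (Poly_Mapping.lookup (induced \<psi> f) p))
       = (\<Sum>g\<in>Poly_Mapping.keys f. F (\<psi> g) (Poly_Mapping.lookup f g))"
  unfolding keys_induced[OF assms]
  by (subst sum.reindex) (auto intro: inj_on_subset[OF assms] simp: lookup_induced[OF assms])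

lemma induced_comp: "inj \<psi> \<Longrightarrow> induced \<phi> (induced \<psi> f) = induced (\<phi> \<circ> \<psi>) f"
  using sum_keys_induced[of \<psi> "\<lambda>p c. Poly_Mapping.single (\<phi> p) c" f]
  by (simp add: induced_def)

lemma induced_funpow:
  assumes "inj \<phi>" shows "(induced \<phi> ^^ i) f = induced (\<phi> ^^ i) f"
proof (induction i)
  case 0
  show ?case by (simp add: induced_def poly_mapping_sum_monomials)
next
  case (Suc i)
  have "inj (\<phi> ^^ i)" using assms by (induction i) (auto intro: inj_compose)
  with Suc show ?case by (simp add: induced_comp comp_def)
qed

section \<open>Word length\<close>

lemma is_word_Nil [simp]: "is_word S []"
  by (simp add: is_word_def)

lemma is_word_append: "is_word S (u @ v) \<longleftrightarrow> is_word S u \<and> is_word S v"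
  by (auto simp: is_word_def)

lemma is_word_rev_uminus: "is_word S ws \<Longrightarrow> is_word S (rev (map uminus ws))"
  by (force simp: is_word_def)

lemma sum_list_rev_uminus:
  fixes ws :: "'g::group_add list"
  shows "sum_list (rev (map uminus ws)) = - sum_list ws"
  by (induction ws) (simp_all add: minus_add)

lemma word_length_le: "is_word S ws \<Longrightarrow> word_length S (sum_list ws) \<le> length ws"
  unfolding word_length_def by (rule Least_le) blast

lemma word_length_0 [simp]: "word_length S 0 = 0"
  using word_length_le[of S "[]"] by simp

lemma word_length_witness:
  assumes "generates S"
  obtains ws where "is_word S ws" "sum_list ws = g" "length ws = word_length S g"
proof -
  obtain ws where "is_word S ws" "sum_list ws = g"
    using assms by (auto simp: generates_def)
  hence "\<exists>n. \<exists>ws. is_word S ws \<and> sum_list ws = g \<and> length ws = n" by blast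
  from LeastI_ex[OF this] show thesis
    using that unfolding word_length_def by blast
qed

lemma word_length_add:
  assumes "generates S"
  shows "word_length S (g + h) \<le> word_length S g + word_length S h"
proof -
  obtain u where u: "is_word S u" "sum_list u = g" "length u = word_length S g"
    using word_length_witness[OF assms] .
  obtain v where v: "is_word S v" "sum_list v = h" "length v = word_length S h"
    using word_length_witness[OF assms] .
  show ?thesis
    using word_length_le[of S "u @ v"] u v by (simp add: is_word_append)
qed

lemma word_length_uminus_le:
  assumes "generates S"
  shows "word_length S (- g) \<le> word_length S g"
proof -
  obtain u where u: "is_word S u" "sum_list u = g" "length u = word_length S g"
    using word_length_witness[OF assms] .
  show ?thesis
    using word_length_le[OF is_word_rev_uminus[OF u(1)]] u(2,3)
    by (simp add: sum_list_rev_uminus)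
qed

text \<open>Subadditivity in both directions, the second using that inversion does not increase
  length. The norm estimates for commutators take this property of \<open>l\<close> as their
  hypothesis.\<close>

lemma word_length_diff:
  assumes "generates S"
  shows "\<bar>real (word_length S h) - real (word_length S (- g + h))\<bar> \<le> real (word_length S g)"
proof -
  have "word_length S h \<le> word_length S g + word_length S (- g + h)"
    using word_length_add[OF assms, of g "- g + h"] by (simp add: add.assoc[symmetric])
  moreover have "word_length S (- g + h) \<le> word_length S g + word_length S h"
    using word_length_add[OF assms, of "- g" h] word_length_uminus_le[OF assms, of g] by linarith
  ultimately show ?thesis by linarith
qed

lemma word_length_pos:
  assumes "generates S" "g \<noteq> 0" shows "word_length S g \<ge> 1"
proof (rule ccontr)
  assume *: "\<not> word_length S g \<ge> 1"
  obtain u where u: "is_word S u" "sum_list u = g" "length u = word_length S g"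
    using word_length_witness[OF assms(1)] .
  have "length u = 0" using * u(3) by linarith
  hence "u = []" by simp
  with u(2) assms(2) show False by simp
qed

section \<open>Bounds for iterated commutators\<close>

text \<open>\<open>mult_length\<close> is diagonal, so each commutator multiplies the matrix entry
  from \<open>- g + h\<close> to \<open>h\<close> by \<open>l h - l (- g + h)\<close>. The induction
  varies \<open>x\<close> because one term of the commutator applies the lower order to
  \<open>mult_length l x\<close>.\<close>

lemma iter_commutator_lam_apply:
  assumes "x \<in> fin_supp"
  shows "ell2_fun (iter_commutator l k (lam f) x) h =
    (\<Sum>g\<in>Poly_Mapping.keys f. Poly_Mapping.lookup f g *
       ((of_nat (l h) - of_nat (l (- g + h))) ^ k * ell2_fun x (- g + h)))"
  using assms
proof (induction k arbitrary: x)
  case 0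
  show ?case by (simp add: lam_apply)
next
  case (Suc k)
  \<comment> \<open>Finiteness selects the nontrivial branch of \<open>mult_length\<close>, which
    vanishes off \<open>fin_supp\<close>.\<close>
  have fin: "finite {h. ell2_fun (iter_commutator l k (lam f) x) h \<noteq> 0}"
    "finite {h. ell2_fun x h \<noteq> 0}"
    using commutators_fin_supp[OF Suc.prems, of l k f] Suc.prems by (auto simp: fin_supp_def)
  show ?case
    using fin Suc.IH[OF Suc.prems] Suc.IH[OF mult_length_fin_supp[OF Suc.prems, of l]]
    by (simp add: minus_ell2.rep_eq mult_length.rep_eq sum_distrib_left sum_subtractf[symmetric]
        algebra_simps)
qed

lemma norm_ell2_le:
  assumes "\<And>h. cmod (ell2_fun x h) \<le> c * cmod (ell2_fun y h)" "c \<ge> 0"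
  shows "norm x \<le> c * norm y"
proof -
  have "(norm x)\<^sup>2 \<le> (\<Sum>\<^sub>\<infinity>h. c\<^sup>2 * (cmod (ell2_fun y h))\<^sup>2)"
    unfolding norm_ell2_square
    using power_mono[OF assms(1), of _ 2]
    by (intro infsum_mono summable_on_cmult_right ell2_summable) (simp add: power_mult_distrib)
  also have "\<dots> = (c * norm y)\<^sup>2"
    by (simp add: infsum_cmult_right[OF ell2_summable] norm_ell2_square power_mult_distrib)
  finally show ?thesis using assms(2) by (intro power2_le_imp_le[of "norm x"]) auto
qed

text \<open>A bound that is uniform in the order \<open>j\<close> of the commutator and of geometric type is stable
  under products: the Leibniz formula for \<open>\<Delta>\<^sup>j\<close> turns it into the binomial formula for
  \<open>(c + c')\<^sup>j\<close>.\<close>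

definition commutator_bound ::
    "('g::group_add \<Rightarrow> nat) \<Rightarrow> real \<Rightarrow> real \<Rightarrow> ('g \<Rightarrow>\<^sub>0 complex) \<Rightarrow> bool"
  where "commutator_bound l M c f \<longleftrightarrow>
    (\<forall>j. \<forall>x\<in>fin_supp. norm (iter_commutator l j (lam f) x) \<le> M * c ^ j * norm x)"

text \<open>The Leibniz formula. The factor of a product telescopes:
  \<open>l h - l (- (g + g') + h)\<close> equals \<open>u g + v g g'\<close>, and the binomial
  formula expands its \<open>k\<close>-th power.\<close>

lemma iter_commutator_mult:
  assumes x: "x \<in> fin_supp"
  shows "iter_commutator l k (lam (a * b)) x =
    (\<Sum>j\<le>k. real (k choose j) *\<^sub>R
       iter_commutator l j (lam a) (iter_commutator l (k - j) (lam b) x))"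
proof (rule ell2_eqI)
  fix h
  define A where "A = Poly_Mapping.keys a"
  define B where "B = Poly_Mapping.keys b"
  define u where "u g = (of_nat (l h) - of_nat (l (- g + h)) :: complex)" for g
  define v where "v g g' = (of_nat (l (- g + h)) - of_nat (l (- g' + (- g + h))) :: complex)" for g g'
  define y where "y g g' = ell2_fun x (- g' + (- g + h))" for g g'
  have assoc: "- (g + g') + h = - g' + (- g + h)" for g g'
    by (simp only: minus_add add.assoc)
  have y: "iter_commutator l j (lam b) x \<in> fin_supp" for j
    by (rule commutators_fin_supp[OF x])
  have "ell2_fun (\<Sum>j\<le>k. real (k choose j) *\<^sub>R
       iter_commutator l j (lam a) (iter_commutator l (k - j) (lam b) x)) h
     = (\<Sum>j\<le>k. of_nat (k choose j) * (\<Sum>g\<in>A. Poly_Mapping.lookup a g * (u g ^ j *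
         (\<Sum>g'\<in>B. Poly_Mapping.lookup b g' * (v g g' ^ (k - j) * y g g')))))"
    by (simp add: ell2_fun_sum scaleR_ell2.rep_eq iter_commutator_lam_apply[OF y]
        iter_commutator_lam_apply[OF x] A_def B_def u_def v_def y_def)
  also have "\<dots> = (\<Sum>g\<in>A. \<Sum>g'\<in>B. \<Sum>j\<le>k. of_nat (k choose j) * (Poly_Mapping.lookup a g * (u g ^ j *
         (Poly_Mapping.lookup b g' * (v g g' ^ (k - j) * y g g')))))"
    unfolding sum_distrib_left
    by (subst sum.swap, intro sum.cong refl, subst sum.swap) simp
  also have "\<dots> = (\<Sum>g\<in>A. \<Sum>g'\<in>B. Poly_Mapping.lookup a g * Poly_Mapping.lookup b g' *
         ((u g + v g g') ^ k * y g g'))"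
    by (simp add: binomial_ring sum_distrib_left sum_distrib_right mult_ac)
  also have "\<dots> = ell2_fun (iter_commutator l k (lam (a * b)) x) h"
    unfolding iter_commutator_lam_apply[OF x] sum_keys_mult
    by (simp add: A_def B_def u_def v_def y_def assoc del: minus_add_distrib)
  finally show "ell2_fun (iter_commutator l k (lam (a * b)) x) h = ell2_fun (\<Sum>j\<le>k. real (k choose j) *\<^sub>R
       iter_commutator l j (lam a) (iter_commutator l (k - j) (lam b) x)) h" ..
qed

lemma commutator_bound_mult:
  assumes a: "commutator_bound l M c a" and b: "commutator_bound l N c' b"
    and pos: "M \<ge> 0" "c \<ge> 0"
  shows "commutator_bound l (M * N) (c + c') (a * b)"
  unfolding commutator_bound_def
proof safe
  fix k and x :: "'a ell2" assume x: "x \<in> fin_supp"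
  have "norm (iter_commutator l k (lam (a * b)) x)
      \<le> (\<Sum>j\<le>k. real (k choose j) *
           norm (iter_commutator l j (lam a) (iter_commutator l (k - j) (lam b) x)))"
    unfolding iter_commutator_mult[OF x] by (rule order_trans[OF norm_sum]) simp
  also have "\<dots> \<le> (\<Sum>j\<le>k. real (k choose j) * (M * c ^ j * (N * c' ^ (k - j) * norm x)))"
  proof (intro sum_mono mult_left_mono)
    fix j
    let ?y = "iter_commutator l (k - j) (lam b) x"
    have "norm (iter_commutator l j (lam a) ?y) \<le> M * c ^ j * norm ?y"
      using a commutators_fin_supp[OF x] by (auto simp: commutator_bound_def)
    also have "\<dots> \<le> M * c ^ j * (N * c' ^ (k - j) * norm x)"
      using b x pos by (intro mult_left_mono) (auto simp: commutator_bound_def)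
    finally show "norm (iter_commutator l j (lam a) ?y) \<le> M * c ^ j * (N * c' ^ (k - j) * norm x)" .
  qed simp
  also have "\<dots> = M * N * (c + c') ^ k * norm x"
    by (simp add: binomial_ring sum_distrib_left sum_distrib_right mult_ac)
  finally show "norm (iter_commutator l k (lam (a * b)) x) \<le> M * N * (c + c') ^ k * norm x" .
qed

text \<open>For a point mass at \<open>g\<close> the pointwise formula has one term, dominated by
  \<open>l g ^ k\<close> times the translate of \<open>x\<close>. Translation is isometric, and the
  triangle inequality gives the general case.\<close>

lemma norm_iter_commutator_le:
  assumes l: "\<And>g h. \<bar>real (l h) - real (l (- g + h))\<bar> \<le> real (l g)" and x: "x \<in> fin_supp"
  shows "norm (iter_commutator l k (lam f) x)
    \<le> (\<Sum>g\<in>Poly_Mapping.keys f. cmod (Poly_Mapping.lookup f g) * real (l g) ^ k) * norm x"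
proof -
  let ?v = "\<lambda>g. iter_commutator l k (lam (Poly_Mapping.single g 1)) x"
  have v: "norm (?v g) \<le> real (l g) ^ k * norm x" for g
  proof -
    have "cmod (ell2_fun (?v g) h) \<le> real (l g) ^ k * cmod (ell2_fun (translate_ell2 g x) h)" for h
    proof -
      have "cmod (of_nat (l h) - of_nat (l (- g + h)))
          = cmod (of_real (real (l h) - real (l (- g + h))))"
        by simp
      also have "\<dots> \<le> real (l g)"
        unfolding norm_of_real by (rule l)
      finally show ?thesis
        by (simp add: iter_commutator_lam_apply[OF x] norm_mult norm_power translate_ell2.rep_eq
            mult_right_mono power_mono)
    qed
    from norm_ell2_le[OF this] show ?thesis by (simp add: norm_translate_ell2)
  qed
  have "iter_commutator l k (lam f) x
      = (\<Sum>g\<in>Poly_Mapping.keys f. scaleC_ell2 (Poly_Mapping.lookup f g) (?v g))"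
    by (rule ell2_eqI) (simp add: iter_commutator_lam_apply[OF x] ell2_fun_sum scaleC_ell2.rep_eq)
  hence "norm (iter_commutator l k (lam f) x)
      \<le> (\<Sum>g\<in>Poly_Mapping.keys f. cmod (Poly_Mapping.lookup f g) * norm (?v g))"
    by (simp add: order_trans[OF norm_sum] norm_scaleC_ell2)
  also have "\<dots> \<le> (\<Sum>g\<in>Poly_Mapping.keys f. cmod (Poly_Mapping.lookup f g) * (real (l g) ^ k * norm x))"
    by (intro sum_mono mult_left_mono v) simp
  also have "\<dots> = (\<Sum>g\<in>Poly_Mapping.keys f. cmod (Poly_Mapping.lookup f g) * real (l g) ^ k) * norm x"
    by (simp add: sum_distrib_right mult.assoc)
  finally show ?thesis .
qed

text \<open>Scalars commute with the length operator. Since \<open>0 ^ 0 = 1\<close>, order 0 still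
  carries the bound \<open>cmod c\<close>. This serves both for the empty product and for
  rescaling.\<close>

lemma commutator_bound_single_0:
  assumes l: "\<And>g h. \<bar>real (l h) - real (l (- g + h))\<bar> \<le> real (l g)" and "l 0 = 0"
  shows "commutator_bound l (cmod c) 0 (Poly_Mapping.single 0 c)"
  unfolding commutator_bound_def
proof safe
  fix j and x :: "'a ell2" assume "x \<in> fin_supp"
  from norm_iter_commutator_le[OF l this, of j "Poly_Mapping.single 0 c"] assms(2)
  show "norm (iter_commutator l j (lam (Poly_Mapping.single 0 c)) x) \<le> cmod c * 0 ^ j * norm x"
    by (cases "c = 0") simp_all
qed

text \<open>The first constant is 1 for every factor, so it stays 1 however long the product is; a
  constant \<open>M > 1\<close> would become \<open>M ^ n\<close> after \<open>n\<close>
  factors.\<close>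

lemma commutator_bound_prod_list:
  assumes l: "\<And>g h. \<bar>real (l h) - real (l (- g + h))\<bar> \<le> real (l g)" "l 0 = 0"
    and "\<And>i. i \<in> set xs \<Longrightarrow> commutator_bound l 1 (c i) (a i) \<and> c i \<ge> 0"
  shows "commutator_bound l 1 (sum_list (map c xs)) (prod_list (map a xs))"
  using assms(3)
proof (induction xs)
  case Nil
  show ?case using commutator_bound_single_0[OF l, of 1] by (simp add: single_one)
next
  case (Cons i xs)
  show ?case using commutator_bound_mult[of l 1 "c i" "a i" 1] Cons by simp
qed

section \<open>Automorphisms\<close>

lemma group_automorphism_inj: "group_automorphism \<phi> \<Longrightarrow> inj \<phi>"
  by (simp add: group_automorphism_def bij_is_inj)

lemma group_automorphism_0:
  assumes "group_automorphism \<phi>" shows "\<phi> 0 = 0"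
proof -
  have "\<phi> 0 + \<phi> 0 = \<phi> 0 + 0" using assms by (metis add_0_right group_automorphism_def)
  thus ?thesis by (simp only: add_left_cancel)
qed

lemma group_automorphism_uminus:
  assumes "group_automorphism \<phi>" shows "\<phi> (- g) = - \<phi> g"
proof -
  have "\<phi> (- g) + \<phi> g = 0"
    using assms by (metis group_automorphism_0 group_automorphism_def left_minus)
  thus ?thesis by (metis minus_unique minus_minus)
qed

lemma group_automorphism_funpow:
  "group_automorphism \<phi> \<Longrightarrow> group_automorphism (\<phi> ^^ n)"
  by (induction n) (auto simp: group_automorphism_def intro: bij_comp)

lemma group_automorphism_sum_list:
  assumes "group_automorphism \<phi>" shows "\<phi> (sum_list ws) = sum_list (map \<phi> ws)"
  using assms by (induction ws) (simp_all add: group_automorphism_0 group_automorphism_def)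

text \<open>A unitary when \<open>\<pi>\<close> is bijective. The value 0 otherwise keeps the result
  square summable for every \<open>\<pi>\<close>, as the lifting requires.\<close>

lift_definition reindex_ell2 :: "('g \<Rightarrow> 'g) \<Rightarrow> 'g ell2 \<Rightarrow> 'g ell2"
  is "\<lambda>\<pi> x h. if bij \<pi> then x (\<pi> h) else 0"
proof goal_cases
  case (1 \<pi> x)
  show ?case
  proof (cases "bij \<pi>")
    case True
    thus ?thesis using 1 summable_on_reindex_bij_betw[OF True, of "\<lambda>h. (cmod (x h))\<^sup>2"] by simp
  qed simp
qed

lemma norm_reindex_ell2: "bij \<pi> \<Longrightarrow> norm (reindex_ell2 \<pi> x) = norm x"
  using infsum_reindex_bij_betw[of \<pi> UNIV UNIV "\<lambda>h. (cmod (ell2_fun x h))\<^sup>2"]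
  by (simp add: norm_ell2_def reindex_ell2.rep_eq)

text \<open>The operators of \<open>\<psi>(f)\<close> and \<open>f\<close> are intertwined by the unitary \<open>x \<mapsto> x \<circ> \<psi>\<close>.\<close>

lemma norm_red_induced_le:
  assumes "group_automorphism \<psi>" shows "norm_red (induced \<psi> f) \<le> norm_red f"
  unfolding norm_red_def
proof (rule norm_blinfun_bound)
  have bij: "bij \<psi>" and inj: "inj \<psi>" using assms by (auto simp: group_automorphism_def bij_is_inj)
  fix x
  have "reindex_ell2 \<psi> (blinfun_apply (lam (induced \<psi> f)) x)
      = blinfun_apply (lam f) (reindex_ell2 \<psi> x)"
  proof (rule ell2_eqI)
    fix h
    have eq: "\<psi> (- g + h) = - \<psi> g + \<psi> h" for g
      using assms by (metis group_automorphism_def group_automorphism_uminus)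
    show "ell2_fun (reindex_ell2 \<psi> (blinfun_apply (lam (induced \<psi> f)) x)) h
        = ell2_fun (blinfun_apply (lam f) (reindex_ell2 \<psi> x)) h"
      using sum_keys_induced[OF inj, of "\<lambda>p c. c * ell2_fun x (- p + \<psi> h)" f]
      by (simp add: reindex_ell2.rep_eq bij lam_apply eq)
  qed
  hence "norm (blinfun_apply (lam (induced \<psi> f)) x)
      = norm (blinfun_apply (lam f) (reindex_ell2 \<psi> x))"
    using norm_reindex_ell2[OF bij] by metis
  also have "\<dots> \<le> norm (lam f) * norm x"
    using norm_blinfun[of "lam f" "reindex_ell2 \<psi> x"] norm_reindex_ell2[OF bij] by simp
  finally show "norm (blinfun_apply (lam (induced \<psi> f)) x) \<le> norm (lam f) * norm x" .
qed simp

text \<open>To keep the first constant equal to 1, order 0 is bounded by the reduced norm, which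
  automorphisms do not increase. For positive orders the sum of the absolute values of the
  coefficients is absorbed into the rate \<open>C * m\<close>.\<close>

lemma commutator_bound_induced:
  assumes l: "\<And>g h. \<bar>real (l h) - real (l (- g + h))\<bar> \<le> real (l g)"
    and \<psi>: "group_automorphism \<psi>" and f: "norm_red f \<le> 1"
    and C: "C \<ge> 1" "(\<Sum>g\<in>Poly_Mapping.keys f. cmod (Poly_Mapping.lookup f g)) \<le> C"
    and m: "\<And>g. g \<in> Poly_Mapping.keys f \<Longrightarrow> real (l (\<psi> g)) \<le> m" "m \<ge> 0"
  shows "commutator_bound l 1 (C * m) (induced \<psi> f)"
  unfolding commutator_bound_def
proof safe
  fix j and x :: "'a ell2" assume x: "x \<in> fin_supp"
  show "norm (iter_commutator l j (lam (induced \<psi> f)) x) \<le> 1 * (C * m) ^ j * norm x"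
  proof (cases "j = 0")
    case True
    have "norm (blinfun_apply (lam (induced \<psi> f)) x) \<le> norm_red (induced \<psi> f) * norm x"
      unfolding norm_red_def by (rule norm_blinfun)
    also have "\<dots> \<le> 1 * norm x"
      using norm_red_induced_le[OF \<psi>, of f] f by (intro mult_right_mono) auto
    finally show ?thesis using True by simp
  next
    case False
    have "norm (iter_commutator l j (lam (induced \<psi> f)) x)
      \<le> (\<Sum>g\<in>Poly_Mapping.keys f. cmod (Poly_Mapping.lookup f g) * real (l (\<psi> g)) ^ j) * norm x"
      using norm_iter_commutator_le[OF l x, of j "induced \<psi> f"]
        sum_keys_induced[OF group_automorphism_inj[OF \<psi>], of "\<lambda>p c. cmod c * real (l p) ^ j" f]
      by simp
    also have "\<dots> \<le> (\<Sum>g\<in>Poly_Mapping.keys f. cmod (Poly_Mapping.lookup f g) * m ^ j) * norm x"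
      using m by (intro mult_right_mono sum_mono mult_left_mono power_mono) auto
    also have "\<dots> = (\<Sum>g\<in>Poly_Mapping.keys f. cmod (Poly_Mapping.lookup f g)) * m ^ j * norm x"
      by (simp add: sum_distrib_right)
    \<comment> \<open>Here \<open>C \<le> C ^ j\<close>, because \<open>C \<ge> 1\<close> and
      \<open>j\<close> is positive.\<close>
    also have "\<dots> \<le> C ^ j * m ^ j * norm x"
      using m C self_le_power[of C j] False by (intro mult_right_mono) auto
    finally show ?thesis by (simp add: power_mult_distrib)
  qed
qed

section \<open>Growth of word length under an automorphism\<close>

lemma word_length_sum_list_le:
  assumes "generates S" "\<And>w. w \<in> set ws \<Longrightarrow> word_length S w \<le> K"
  shows "word_length S (sum_list ws) \<le> K * length ws"
  using assms(2)
proof (induction ws)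
  case (Cons w ws)
  thus ?case using word_length_add[OF assms(1), of w "sum_list ws"] by (force simp: algebra_simps)
qed simp

lemma word_length_automorphism_le:
  assumes "finite S" "generates S" "group_automorphism \<phi>"
  obtains K where "\<And>g n. word_length S ((\<phi> ^^ n) g) \<le> K ^ n * word_length S g"
proof -
  \<comment> \<open>The sum replaces the maximum over the generators and makes sense for empty
    \<open>S\<close> as well.\<close>
  define K where "K = (\<Sum>s\<in>S. word_length S (\<phi> s))"
  have K: "word_length S (\<phi> s) \<le> K" if "s \<in> S \<union> uminus ` S" for s
  proof -
    from that obtain s' where s': "s' \<in> S" "s = s' \<or> s = - s'" by auto
    have "word_length S (\<phi> s) \<le> word_length S (\<phi> s')"
      using s'(2) word_length_uminus_le[OF assms(2), of "\<phi> s'"]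
        group_automorphism_uminus[OF assms(3), of s'] by auto
    also have "\<dots> \<le> K"
      unfolding K_def using assms(1) s'(1) by (intro member_le_sum) auto
    finally show ?thesis .
  qed
  have step: "word_length S (\<phi> g) \<le> K * word_length S g" for g
  proof -
    obtain ws where ws: "is_word S ws" "sum_list ws = g" "length ws = word_length S g"
      using word_length_witness[OF assms(2)] .
    have "word_length S (sum_list (map \<phi> ws)) \<le> K * length (map \<phi> ws)"
      using ws(1) K by (intro word_length_sum_list_le[OF assms(2)]) (auto simp: is_word_def)
    thus ?thesis using ws group_automorphism_sum_list[OF assms(3), of ws] by simp
  qed
  have "word_length S ((\<phi> ^^ n) g) \<le> K ^ n * word_length S g" for g n
  proof (induction n)
    case (Suc n)
    have "word_length S ((\<phi> ^^ Suc n) g) \<le> K * word_length S ((\<phi> ^^ n) g)"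
      using step by simp
    also have "\<dots> \<le> K * (K ^ n * word_length S g)" using Suc by (rule mult_left_mono) simp
    finally show ?case by (simp add: mult.assoc)
  qed simp
  thus thesis by (rule that)
qed

definition growth_rate :: "('g \<Rightarrow> nat) \<Rightarrow> ('g \<Rightarrow> 'g) \<Rightarrow> ereal"
  where "growth_rate l \<phi> = (SUP g. limsup (\<lambda>n. ereal (root n (real (l ((\<phi> ^^ n) g))))))"

lemma growth_rate_less_top:
  assumes "finite S" "generates S" "group_automorphism \<phi>"
  shows "growth_rate (word_length S) \<phi> < \<infinity>"
proof -
  obtain K where K: "\<And>g n. word_length S ((\<phi> ^^ n) g) \<le> K ^ n * word_length S g"
    using word_length_automorphism_le[OF assms] by blast
  have "limsup (\<lambda>n. ereal (root n (real (word_length S ((\<phi> ^^ n) g))))) \<le> ereal (real K)" for g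
  proof -
    \<comment> \<open>The added 1 makes \<open>c\<close> positive, so its \<open>n\<close>-th roots
      tend to 1 even when \<open>g = 0\<close>.\<close>
    define c where "c = real (word_length S g) + 1"
    have "limsup (\<lambda>n. ereal (root n (real (word_length S ((\<phi> ^^ n) g)))))
        \<le> limsup (\<lambda>n. ereal (real K * root n c))"
    proof (intro Limsup_mono eventually_mono[OF eventually_gt_at_top[of 0]])
      fix n :: nat assume n: "0 < n"
      have "real (word_length S ((\<phi> ^^ n) g)) \<le> real (K ^ n * word_length S g)"
        using K by (rule of_nat_mono)
      also have "\<dots> \<le> real K ^ n * c" by (simp add: c_def mult_left_mono)
      finally have "root n (real (word_length S ((\<phi> ^^ n) g))) \<le> root n (real K ^ n * c)"
        using n by simp
      also have "\<dots> = real K * root n c"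
        using n by (simp add: real_root_mult real_root_power_cancel)
      finally show "ereal (root n (real (word_length S ((\<phi> ^^ n) g)))) \<le> ereal (real K * root n c)"
        by simp
    qed
    also have "(\<lambda>n. ereal (real K * root n c)) \<longlonglongrightarrow> ereal (real K * 1)"
      by (intro tendsto_ereal tendsto_intros LIMSEQ_root_const) (simp add: c_def)
    hence "limsup (\<lambda>n. ereal (real K * root n c)) = ereal (real K)"
      by (simp add: lim_imp_Limsup)
    finally show ?thesis .
  qed
  hence "growth_rate (word_length S) \<phi> \<le> ereal (real K)"
    unfolding growth_rate_def by (rule SUP_least)
  thus ?thesis by (rule order_le_less_trans) simp
qed

text \<open>An infinite group has some \<open>g \<noteq> 0\<close>, whose orbit avoids 0 and so has
  lengths at least 1. In the trivial group the rate would be 0 and its logarithm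
  \<open>-\<infinity>\<close>.\<close>

lemma growth_rate_ge_1:
  fixes S :: "'g::group_add set"
  assumes "infinite (UNIV :: 'g set)" "generates S" "group_automorphism \<phi>"
  shows "growth_rate (word_length S) \<phi> \<ge> 1"
proof -
  obtain g :: 'g where g: "g \<noteq> 0"
    using assms(1) by (metis (full_types) UNIV_eq_I finite.simps insertCI)
  have "1 \<le> limsup (\<lambda>n. ereal (root n (real (word_length S ((\<phi> ^^ n) g)))))"
  proof (rule le_Limsup)
    show "\<forall>\<^sub>F n in sequentially. 1 \<le> ereal (root n (real (word_length S ((\<phi> ^^ n) g))))"
    proof (rule eventually_mono[OF eventually_gt_at_top[of 0]])
      fix n :: nat assume n: "0 < n"
      note aut = group_automorphism_funpow[OF assms(3), of n]
      have "(\<phi> ^^ n) g \<noteq> 0"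
        using g group_automorphism_0[OF aut] inj_eq[OF group_automorphism_inj[OF aut]] by metis
      from word_length_pos[OF assms(2) this] n
      show "1 \<le> ereal (root n (real (word_length S ((\<phi> ^^ n) g))))" by simp
    qed
  qed simp
  also have "\<dots> \<le> growth_rate (word_length S) \<phi>"
    unfolding growth_rate_def by (rule SUP_upper) simp
  finally show ?thesis .
qed

lemma growth_rate_bound:
  assumes "growth_rate l \<phi> < ereal q" "q \<ge> 1" "finite W"
  obtains A where "A > 0" "\<And>g n. g \<in> W \<Longrightarrow> real (l ((\<phi> ^^ n) g)) \<le> A * q ^ n"
proof -
  have "\<exists>A>0. \<forall>n. real (l ((\<phi> ^^ n) g)) \<le> A * q ^ n" for g
  proof -
    have "limsup (\<lambda>n. ereal (root n (real (l ((\<phi> ^^ n) g))))) < ereal q"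
      by (rule order_le_less_trans[OF _ assms(1)]) (auto simp: growth_rate_def intro: SUP_upper)
    from Limsup_lessD[OF this]
    have "\<forall>\<^sub>F n in sequentially. root n (real (l ((\<phi> ^^ n) g))) < q \<and> n > 0"
      by (auto intro: eventually_conj eventually_gt_at_top)
    then obtain N where N: "\<And>n. n \<ge> N \<Longrightarrow> root n (real (l ((\<phi> ^^ n) g))) < q \<and> n > 0"
      by (auto simp: eventually_sequentially)
    \<comment> \<open>The limsup controls only \<open>n \<ge> N\<close>; the finitely many earlier
      lengths go into \<open>A\<close>, where \<open>q \<ge> 1\<close> lets them be compared with
      \<open>A * q ^ n\<close>.\<close>
    define A where "A = 1 + (\<Sum>i<N. real (l ((\<phi> ^^ i) g)))"
    have A: "A \<ge> 1" by (simp add: A_def sum_nonneg)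
    have "real (l ((\<phi> ^^ n) g)) \<le> A * q ^ n" for n
    proof (cases "n < N")
      case True
      have "real (l ((\<phi> ^^ n) g)) \<le> A * 1"
        using member_le_sum[of n "{..<N}" "\<lambda>i. real (l ((\<phi> ^^ i) g))"] True by (simp add: A_def)
      also have "\<dots> \<le> A * q ^ n" using A assms(2) by (intro mult_left_mono) auto
      finally show ?thesis .
    next
      case False
      have "real (l ((\<phi> ^^ n) g)) = root n (real (l ((\<phi> ^^ n) g))) ^ n"
        using N[of n] False by simp
      also have "\<dots> \<le> 1 * q ^ n"
        using N[of n] False by (simp add: power_mono del: real_root_pow_pos2)
      also have "\<dots> \<le> A * q ^ n" using A assms(2) by (intro mult_right_mono) auto
      finally show ?thesis .
    qed
    thus ?thesis using A by (intro exI[of _ A]) auto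
  qed
  then obtain A where A: "\<And>g. A g > 0" "\<And>g n. real (l ((\<phi> ^^ n) g)) \<le> A g * q ^ n"
    by metis
  show thesis
  \<comment> \<open>The summand 1 keeps the constant positive for empty \<open>W\<close>.\<close>
  proof (rule that[of "1 + (\<Sum>g\<in>W. A g)"])
    show "1 + (\<Sum>g\<in>W. A g) > 0" using A(1) by (simp add: add_pos_nonneg sum_nonneg less_imp_le)
    fix g n assume g: "g \<in> W"
    have "A g \<le> 1 + (\<Sum>g\<in>W. A g)"
      using member_le_sum[OF g, of A] assms(3) A(1) by (simp add: less_imp_le)
    hence "A g * q ^ n \<le> (1 + (\<Sum>g\<in>W. A g)) * q ^ n"
      using assms(2) by (intro mult_right_mono) auto
    with A(2) show "real (l ((\<phi> ^^ n) g)) \<le> (1 + (\<Sum>g\<in>W. A g)) * q ^ n"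
      by (rule order_trans)
  qed
qed

section \<open>Approximation dimension\<close>

interpretation bop: vector_space "scaleC_bop :: complex \<Rightarrow> 'a bop \<Rightarrow> 'a bop"
  by (rule vector_space_bop)

lemma norm_scaleC_bop_le: "norm (scaleC_bop c T) \<le> cmod c * norm T"
proof (rule norm_blinfun_bound)
  fix x
  show "norm (blinfun_apply (scaleC_bop c T) x) \<le> cmod c * norm T * norm x"
    using mult_left_mono[OF norm_blinfun[of T x], of "cmod c"]
    by (simp add: scaleC_bop_apply norm_scaleC_ell2 mult.assoc)
qed simp

text \<open>A subspace is invariant under scaling: multiplying an approximant of \<open>s y\<close>
  by \<open>1 / s\<close> gives an approximant of \<open>y\<close> in the same subspace, with the
  error divided by \<open>s\<close>.\<close>

lemma approx_dim_le_scaled: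
  fixes Y Y' :: "'a bop set"
  assumes s: "s > 0" and Y: "\<And>y. y \<in> Y' \<Longrightarrow> scaleC_bop (of_real s) y \<in> Y"
  shows "approx_dim scaleC_bop X Y' \<delta> \<le> approx_dim scaleC_bop X Y (s * \<delta>)"
  unfolding approx_dim_def
proof (rule Inf_superset_mono, clarify)
  fix Z B :: "'a bop set"
  assume Z: "bop.span B \<subseteq> X" "bop.subspace (bop.span B)" "finite B"
    "\<forall>y\<in>Y. \<exists>z\<in>bop.span B. norm (y - z) < s * \<delta>"
  have "\<exists>z\<in>bop.span B. norm (y - z) < \<delta>" if "y \<in> Y'" for y
  proof -
    obtain z where z: "z \<in> bop.span B" "norm (scaleC_bop (of_real s) y - z) < s * \<delta>"
      using Z(4) Y \<open>y \<in> Y'\<close> by blast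
    let ?z = "scaleC_bop (of_real (1 / s)) z"
    have "y - ?z = scaleC_bop (of_real (1 / s)) (scaleC_bop (of_real s) y - z)"
      using s by (simp add: bop.scale_right_diff_distrib flip: of_real_mult)
    hence "norm (y - ?z) \<le> 1 / s * norm (scaleC_bop (of_real s) y - z)"
      using norm_scaleC_bop_le[of "of_real (1 / s)" "scaleC_bop (of_real s) y - z"] s
      by (simp add: norm_divide)
    also have "\<dots> < 1 / s * (s * \<delta>)"
      using z(2) s by (intro mult_strict_left_mono) auto
    finally show ?thesis
      using s z(1) by (intro bexI[of _ ?z] bop.span_scale) simp_all
  qed
  with Z show "\<exists>Z'. enat (bop.dim (bop.span B)) = enat (bop.dim Z') \<and> Z' \<subseteq> X \<and>
      bop.subspace Z' \<and> (\<exists>B. finite B \<and> bop.span B = Z') \<and> (\<forall>y\<in>Y'. \<exists>z\<in>Z'. norm (y - z) < \<delta>)"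
    by (intro exI[of _ "bop.span B"]) blast
qed

lemma approx_dim_ge_1:
  fixes Y :: "'a bop set"
  assumes "y \<in> Y" "norm y \<ge> \<delta>"
  shows "approx_dim scaleC_bop X Y \<delta> \<ge> 1"
  unfolding approx_dim_def
proof (rule Inf_greatest, clarify)
  fix B :: "'a bop set"
  assume B: "finite B" "\<forall>y\<in>Y. \<exists>z\<in>bop.span B. norm (y - z) < \<delta>"
  then obtain z where z: "z \<in> bop.span B" "norm (y - z) < \<delta>"
    using assms(1) by blast
  obtain B' where B': "B' \<subseteq> bop.span B" "bop.independent B'" "bop.span B \<subseteq> bop.span B'"
    "card B' = bop.dim (bop.span B)"
    using bop.basis_exists[of "bop.span B"] by blast
  \<comment> \<open>An infinite set has \<open>card\<close> 0, so finiteness is needed before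
    dimension 0 can mean an empty basis.\<close>
  have "finite B'" using bop.independent_span_bound[OF B(1) B'(2,1)] by simp
  have "bop.dim (bop.span B) \<noteq> 0"
  proof
    assume "bop.dim (bop.span B) = 0"
    with B'(4) \<open>finite B'\<close> have "B' = {}" by simp
    with z B'(3) assms(2) show False by auto
  qed
  thus "1 \<le> enat (bop.dim (bop.span B))" by (simp add: one_enat_def)
qed

section \<open>Metric dimension\<close>

lemma eln_mono: "x \<le> y \<Longrightarrow> eln x \<le> eln y"
  by (cases x; cases y) (auto simp: eln_def)

lemma eln_nonneg: "x \<ge> 1 \<Longrightarrow> eln x \<ge> 0"
  by (cases x) (auto simp: eln_def)

lemma Lseminorm_lam_le:
  assumes "commutator_bound l M c f" "M \<ge> 0" "c \<ge> 0"
  shows "Lseminorm l k (lam f) \<le> ereal (M * c ^ k)"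
proof -
  have "norm (iter_commutator l k (lam f) x) \<le> M * c ^ k" if "x \<in> fin_supp" "norm x \<le> 1" for x
  proof -
    have "norm (iter_commutator l k (lam f) x) \<le> M * c ^ k * norm x"
      using assms(1) that(1) by (simp add: commutator_bound_def)
    also have "\<dots> \<le> M * c ^ k * 1" using assms that(2) by (intro mult_left_mono) auto
    finally show ?thesis by simp
  qed
  thus ?thesis by (auto simp: Lseminorm_def dense_opnorm_def intro!: SUP_least)
qed

lemma lam_one: "lam 1 = (id_blinfun :: 'g::group_add bop)"
  by (intro blinfun_eqI ell2_eqI) (simp add: lam_apply)

text \<open>Writing a scalar as a convolution factor lets \<open>commutator_bound_mult\<close>
  handle rescaling.\<close>

lemma lam_single_0_mult: "lam (Poly_Mapping.single 0 c * f) = scaleC_bop c (lam f)"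
proof (intro blinfun_eqI ell2_eqI)
  fix x h
  show "ell2_fun (blinfun_apply (lam (Poly_Mapping.single 0 c * f)) x) h
      = ell2_fun (blinfun_apply (scaleC_bop c (lam f)) x) h"
    using sum_keys_mult[of "Poly_Mapping.single 0 c" f "\<lambda>p. ell2_fun x (- p + h)"]
    by (simp add: lam_apply scaleC_bop_apply scaleC_ell2.rep_eq sum_distrib_left mult.assoc)
qed

lemma lam_in_Cstar_red: "lam f \<in> Cstar_red"
  unfolding Cstar_red_def by (rule subsetD[OF closure_subset]) simp

lemma norm_id_bop: "norm (id_blinfun :: 'g::group_add bop) = 1"
proof -
  \<comment> \<open>The point mass at 0 shows that the space is nonzero, which the lower bound on
    the norm requires.\<close>
  define x :: "'g ell2" where "x = Abs_ell2 (\<lambda>h. if h = 0 then 1 else 0)"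
  have "ell2_fun x = (\<lambda>h. if h = 0 then 1 else 0)"
    unfolding x_def by (intro Abs_ell2_inverse) (simp add: square_summable_fin_supp)
  hence "x \<noteq> 0" by (metis zero_ell2.rep_eq zero_neq_one)
  have "norm x \<le> norm (id_blinfun :: 'g bop) * norm x"
    using norm_blinfun[of id_blinfun x] by simp
  hence "norm (id_blinfun :: 'g bop) \<ge> 1" using \<open>x \<noteq> 0\<close> by simp
  thus ?thesis using norm_blinfun_id_le by (rule antisym[rotated])
qed

text \<open>The identity has norm 1 and, as \<open>k > 0\<close>, seminorm 0; for
  \<open>\<delta> < 1\<close> the zero subspace cannot approximate it. This rules out the value
  \<open>-\<infinity>\<close> for the dimension.\<close>

lemma Mdim_nonneg:
  fixes l :: "'g::group_add \<Rightarrow> nat"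
  assumes l: "\<And>g h. \<bar>real (l h) - real (l (- g + h))\<bar> \<le> real (l g)" "l 0 = 0" and "k > 0"
  shows "Mdim scaleC_bop (Lseminorm l k) Cstar_red \<ge> 0"
  unfolding Mdim_def
proof (rule le_Limsup)
  let ?Y = "{a \<in> Cstar_red. Lseminorm l k a < 1}"
  have "Lseminorm l k (lam 1) \<le> 0"
    using Lseminorm_lam_le[OF commutator_bound_single_0[OF l, of 1], of k] assms(3)
    by (simp add: single_one zero_ereal_def power_0_left)
  hence "id_blinfun \<in> ?Y"
    using lam_in_Cstar_red[of "1 :: 'g \<Rightarrow>\<^sub>0 complex"] by (simp add: lam_one order_le_less_trans)
  hence D: "approx_dim scaleC_bop Cstar_red ?Y \<delta> \<ge> 1" if "\<delta> < 1" for \<delta>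
    using that by (intro approx_dim_ge_1[of "id_blinfun"]) (auto simp: norm_id_bop)
  have "eventually (\<lambda>\<delta>::real. \<delta> \<in> {0<..<1}) (at_right 0)"
    by (rule eventually_at_right_real) simp
  thus "\<forall>\<^sub>F \<delta> in at_right 0.
      0 \<le> eln (ereal_of_enat (approx_dim scaleC_bop Cstar_red ?Y \<delta>)) / ereal (ln (1 / \<delta>))"
  proof eventually_elim
    case (elim \<delta>)
    have "1 \<le> ereal_of_enat (approx_dim scaleC_bop Cstar_red ?Y \<delta>)"
      using D[of \<delta>] elim ereal_of_enat_le_iff[of 1] by (simp add: one_enat_def one_ereal_def)
    moreover have "0 \<le> ln (1 / \<delta>)" using elim by (intro ln_ge_zero) simp
    ultimately show ?case by (intro zero_le_divide_ereal eln_nonneg) auto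
  qed
qed simp

section \<open>Entropy\<close>

lemma commutator_bound_mono:
  assumes "commutator_bound l M c f" "0 \<le> M" "0 \<le> c" "c \<le> c'"
  shows "commutator_bound l M c' f"
  unfolding commutator_bound_def
proof safe
  fix j and x :: "'a ell2" assume "x \<in> fin_supp"
  with assms(1) have "norm (iter_commutator l j (lam f) x) \<le> M * c ^ j * norm x"
    by (simp add: commutator_bound_def)
  also have "\<dots> \<le> M * c' ^ j * norm x"
    using assms by (intro mult_right_mono mult_left_mono power_mono) auto
  finally show "norm (iter_commutator l j (lam f) x) \<le> M * c' ^ j * norm x" .
qed

lemma orbit_products_commutator_bound:
  assumes l: "\<And>g h. \<bar>real (l h) - real (l (- g + h))\<bar> \<le> real (l g)" "l 0 = 0"
    and \<phi>: "group_automorphism \<phi>"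
    and \<Omega>: "finite \<Omega>" "\<And>f. f \<in> \<Omega> \<Longrightarrow> norm_red f \<le> 1"
    and q: "growth_rate l \<phi> < ereal q" "q > 1"
  obtains B where "B > 0"
    "\<And>n b. b \<in> orbit_products \<phi> \<Omega> n \<Longrightarrow> commutator_bound l 1 (B * q ^ n) b"
proof -
  define W where "W = (\<Union>f\<in>\<Omega>. Poly_Mapping.keys f)"
  define N where "N f = (\<Sum>g\<in>Poly_Mapping.keys f. cmod (Poly_Mapping.lookup f g))"
    for f :: "'a \<Rightarrow>\<^sub>0 complex"
  \<comment> \<open>One constant for all of \<open>\<Omega>\<close>, at least 1 as
    \<open>commutator_bound_induced\<close> demands.\<close>
  define C where "C = 1 + (\<Sum>f\<in>\<Omega>. N f)"
  have N: "N f \<ge> 0" for f by (simp add: N_def sum_nonneg)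
  have C: "C \<ge> 1" by (simp add: C_def sum_nonneg N)
  have NC: "N f \<le> C" if "f \<in> \<Omega>" for f
    using member_le_sum[OF that, of N] \<Omega>(1) N by (simp add: C_def)
  have "finite W" using \<Omega>(1) by (simp add: W_def)
  then obtain A where A: "A > 0" "\<And>g n. g \<in> W \<Longrightarrow> real (l ((\<phi> ^^ n) g)) \<le> A * q ^ n"
    using growth_rate_bound[OF q(1), of W] q(2) by auto
  define c where "c i = C * (A * q ^ i)" for i
  \<comment> \<open>From the geometric sum of the rates \<open>c i\<close>, which is
    \<open>C * A * (q ^ n - 1) / (q - 1)\<close>.\<close>
  define B where "B = C * A / (q - 1)"
  show thesis
  proof (rule that[of B])
    show "B > 0" using C A q by (simp add: B_def)
    fix n b assume "b \<in> orbit_products \<phi> \<Omega> n"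
    then obtain a where a: "b = prod_list (map a [0..<n])" "\<forall>i<n. a i \<in> (induced \<phi> ^^ i) ` \<Omega>"
      by (auto simp: orbit_products_def)
    have bound: "commutator_bound l 1 (c i) (a i)" if i: "i < n" for i
    proof -
      obtain f where f: "f \<in> \<Omega>" "a i = induced (\<phi> ^^ i) f"
        using a(2) i induced_funpow[OF group_automorphism_inj[OF \<phi>]] by auto
      have "commutator_bound l 1 (C * (A * q ^ i)) (induced (\<phi> ^^ i) f)"
      proof (rule commutator_bound_induced[OF l(1) group_automorphism_funpow[OF \<phi>]])
        show "(\<Sum>g\<in>Poly_Mapping.keys f. cmod (Poly_Mapping.lookup f g)) \<le> C"
          using NC[OF f(1)] by (simp add: N_def)
      qed (use f \<Omega> C A q in \<open>auto simp: W_def\<close>)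
      thus ?thesis by (simp add: f c_def)
    qed
    have c0: "c i \<ge> 0" for i using C A q by (simp add: c_def)
    have b: "commutator_bound l 1 (sum_list (map c [0..<n])) b"
      unfolding a(1) by (intro commutator_bound_prod_list[OF l] conjI bound c0) simp
    have nonneg: "0 \<le> sum_list (map c [0..<n])" by (intro sum_list_nonneg) (auto simp: c0)
    have "sum_list (map c [0..<n]) \<le> B * q ^ n"
    proof -
      have "sum_list (map c [0..<n]) = (\<Sum>i<n. c i)"
        by (simp add: interv_sum_list_conv_sum_set_nat atLeast0LessThan)
      also have "\<dots> = C * A * (\<Sum>i<n. q ^ i)"
        by (simp add: c_def sum_distrib_left mult.assoc)
      also have "\<dots> = B * (q ^ n - 1)"
        using q by (simp add: geometric_sum B_def)
      also have "\<dots> \<le> B * q ^ n" using \<open>B > 0\<close> by (intro mult_left_mono) auto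
      finally show ?thesis .
    qed
    thus "commutator_bound l 1 (B * q ^ n) b"
      by (rule commutator_bound_mono[OF b zero_le_one nonneg])
  qed
qed

lemma Entp_at_le:
  assumes l: "\<And>g h. \<bar>real (l h) - real (l (- g + h))\<bar> \<le> real (l g)" "l 0 = 0"
    and \<phi>: "group_automorphism \<phi>"
    and \<Omega>: "finite \<Omega>" "\<And>f. f \<in> \<Omega> \<Longrightarrow> norm_red f \<le> 1"
    and q: "growth_rate l \<phi> < ereal q" "q > 1"
    and "k > 0" "\<delta> > 0"
    and d: "Mdim scaleC_bop (Lseminorm l k) Cstar_red < ereal d" "d > 0"
  shows "Entp_at \<phi> \<Omega> \<delta> \<le> ereal (d * (real k * ln q))"
proof -
  let ?D = "approx_dim scaleC_bop Cstar_red {a \<in> Cstar_red. Lseminorm l k a < 1}"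
  obtain B where B: "B > 0"
    "\<And>n b. b \<in> orbit_products \<phi> \<Omega> n \<Longrightarrow> commutator_bound l 1 (B * q ^ n) b"
    using orbit_products_commutator_bound[OF l \<phi> \<Omega> q] by blast
  \<comment> \<open>The factor 2 brings the scaled seminorm down to at most \<open>1 / 2\<close>,
    strictly below the threshold 1.\<close>
  define s where "s n = 1 / (2 * (B * q ^ n) ^ k)" for n
  have s: "s n > 0" for n using B q by (simp add: s_def)
  have D: "approx_dim scaleC_bop Cstar_red (lam ` orbit_products \<phi> \<Omega> n) \<delta> \<le> ?D (s n * \<delta>)" for n
  proof (rule approx_dim_le_scaled[OF s])
    fix y assume "y \<in> lam ` orbit_products \<phi> \<Omega> n"
    then obtain b where b: "b \<in> orbit_products \<phi> \<Omega> n" "y = lam b" by blast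
    let ?b = "Poly_Mapping.single 0 (complex_of_real (s n)) * b"
    have "commutator_bound l (s n) (B * q ^ n) ?b"
      using commutator_bound_mult[OF commutator_bound_single_0[OF l, of "of_real (s n)"] B(2)[OF b(1)]]
        s[of n] by simp
    hence "Lseminorm l k (lam ?b) \<le> ereal (s n * (B * q ^ n) ^ k)"
      using s[of n] B(1) q by (intro Lseminorm_lam_le) auto
    also have "s n * (B * q ^ n) ^ k = 1 / 2" using B(1) q by (simp add: s_def)
    finally have "Lseminorm l k (lam ?b) < 1" by (rule order_le_less_trans) simp
    thus "scaleC_bop (of_real (s n)) y \<in> {a \<in> Cstar_red. Lseminorm l k a < 1}"
      using lam_in_Cstar_red[of ?b] by (simp add: lam_single_0_mult b(2))
  qed
  \<comment> \<open>The part of the logarithm independent of \<open>n\<close>; it disappears after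
    division by \<open>n\<close>.\<close>
  define K where "K = ln (2 * B ^ k / \<delta>)"
  have ln_s: "ln (1 / (s n * \<delta>)) = K + real n * (real k * ln q)" for n
  proof -
    have "1 / (s n * \<delta>) = 2 * B ^ k / \<delta> * q ^ (n * k)"
      by (simp add: s_def power_mult_distrib power_mult)
    also have "ln \<dots> = K + ln (q ^ (n * k))"
      unfolding K_def using B(1) q \<open>\<delta> > 0\<close> by (intro ln_mult_pos) auto
    finally show ?thesis using q by (simp add: ln_realpow)
  qed
  \<comment> \<open>The scales \<open>s n * \<delta>\<close> decrease to 0 from the right, so a
    bound near 0 for the metric dimension can be evaluated along them.\<close>
  have "(\<lambda>n. \<delta> / (2 * B ^ k) * (1 / q ^ k) ^ n) \<longlonglongrightarrow> 0"
    using q \<open>k > 0\<close> by (intro tendsto_mult_right_zero LIMSEQ_realpow_zero) auto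
  also have "(\<lambda>n. \<delta> / (2 * B ^ k) * (1 / q ^ k) ^ n) = (\<lambda>n. s n * \<delta>)"
    by (simp add: s_def fun_eq_iff power_mult_distrib power_divide mult.commute flip: power_mult)
  finally have lim: "filterlim (\<lambda>n. s n * \<delta>) (at_right 0) sequentially"
    using s \<open>\<delta> > 0\<close> by (intro tendsto_imp_filterlim_at_right) auto
  have "\<forall>\<^sub>F \<epsilon> in at_right 0. eln (ereal_of_enat (?D \<epsilon>)) / ereal (ln (1 / \<epsilon>)) < ereal d"
    using Limsup_lessD[OF d(1)[unfolded Mdim_def]] .
  moreover have "\<forall>\<^sub>F \<epsilon>::real in at_right 0. \<epsilon> \<in> {0<..<1}"
    by (rule eventually_at_right_real) simp
  ultimately have "\<forall>\<^sub>F \<epsilon> in at_right 0. eln (ereal_of_enat (?D \<epsilon>)) \<le> ereal (d * ln (1 / \<epsilon>))"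
  proof eventually_elim
    case (elim \<epsilon>)
    \<comment> \<open>With a positive denominator the strict bound excludes the value
      \<open>\<infinity>\<close> of \<open>eln\<close>; for \<open>-\<infinity>\<close> the claim is
      trivial.\<close>
    have "ln (1 / \<epsilon>) > 0" using elim by (intro ln_gt_zero) simp
    with elim(1) show ?case
      by (cases "eln (ereal_of_enat (?D \<epsilon>))") (auto simp: divide_less_eq)
  qed
  hence "\<forall>\<^sub>F n in sequentially. eln (ereal_of_enat (?D (s n * \<delta>))) \<le> ereal (d * ln (1 / (s n * \<delta>)))"
    using lim by (rule eventually_compose_filterlim)
  hence "\<forall>\<^sub>F n in sequentially.
      eln (ereal_of_enat (approx_dim scaleC_bop Cstar_red (lam ` orbit_products \<phi> \<Omega> n) \<delta>)) / ereal (real n)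
      \<le> ereal (d * (K / real n + real k * ln q))"
    using eventually_gt_at_top[of 0]
  proof eventually_elim
    case (elim n)
    let ?E = "eln (ereal_of_enat (approx_dim scaleC_bop Cstar_red (lam ` orbit_products \<phi> \<Omega> n) \<delta>))"
    have "?E \<le> eln (ereal_of_enat (?D (s n * \<delta>)))"
      by (intro eln_mono) (simp add: D)
    also have "\<dots> \<le> ereal (d * (K + real n * (real k * ln q)))"
      using elim(1) by (simp only: ln_s)
    finally have "?E / ereal (real n) \<le> ereal (d * (K + real n * (real k * ln q))) / ereal (real n)"
      using elim(2) by (intro ereal_divide_right_mono) auto
    also have "\<dots> = ereal (d * (K / real n + real k * ln q))"
      using elim(2) by (simp add: field_simps)
    finally show ?case .
  qed
  hence "Entp_at \<phi> \<Omega> \<delta> \<le> limsup (\<lambda>n. ereal (d * (K / real n + real k * ln q)))"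
    unfolding Entp_at_def by (rule Limsup_mono)
  also have "(\<lambda>n. ereal (d * (K / real n + real k * ln q))) \<longlonglongrightarrow> ereal (d * (0 + real k * ln q))"
    by (intro tendsto_ereal tendsto_intros lim_const_over_n)
  hence "limsup (\<lambda>n. ereal (d * (K / real n + real k * ln q))) = ereal (d * (real k * ln q))"
    by (simp add: lim_imp_Limsup)
  finally show ?thesis .
qed

theorem theorem3p13:
  fixes S :: "'g::group_add set" and r :: real and k :: nat and d :: ereal
    and \<phi> :: "'g \<Rightarrow> 'g"
  assumes "infinite (UNIV :: 'g set)"
    and "finite S" and "generates S"
    and "r > 0" and "rapid_decay (word_length S) r"
    and "real k > r"
    and "Mdim scaleC_bop (Lseminorm (word_length S) k) Cstar_red = d" and "d < \<infinity>"
    and "group_automorphism \<phi>"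
  shows "Entp \<phi> \<le> ereal (real k) * d * h_geo (word_length S) \<phi>"
proof -
  note l = word_length_diff[OF assms(3)] word_length_0[of S]
  have k: "k > 0" using assms(4,6) by (intro gr0I) auto
  have "d \<ge> 0" using Mdim_nonneg[OF l k] assms(7) by simp
  then obtain d0 where d0: "d = ereal d0" "d0 \<ge> 0" using assms(8) by (cases d) auto
  obtain G where G: "growth_rate (word_length S) \<phi> = ereal G" "G \<ge> 1"
    using growth_rate_less_top[OF assms(2,3,9)] growth_rate_ge_1[OF assms(1,3,9)]
    by (cases "growth_rate (word_length S) \<phi>") auto
  \<comment> \<open>Since \<open>G \<ge> 1\<close>, \<open>eln\<close> is the ordinary logarithm
    here.\<close>
  have h: "h_geo (word_length S) \<phi> = ereal (ln G)"
    using G by (simp add: h_geo_def eln_def flip: growth_rate_def)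
  \<comment> \<open>The increments give the strict inequalities required by
    \<open>Entp_at_le\<close>, including in the borderline cases \<open>d0 = 0\<close> and
    \<open>G = 1\<close>.\<close>
  have *: "Entp \<phi> \<le> ereal ((d0 + inverse (real (Suc n))) * (real k * ln (G + inverse (real (Suc n)))))" for n
  proof -
    define e where "e = inverse (real (Suc n))"
    have e: "e > 0" by (simp add: e_def)
    have "Entp_at \<phi> \<Omega> \<delta> \<le> ereal ((d0 + e) * (real k * ln (G + e)))"
      if "finite \<Omega>" "\<And>f. f \<in> \<Omega> \<Longrightarrow> norm_red f \<le> 1" "\<delta> > 0" for \<Omega> \<delta>
      using that by (intro Entp_at_le[OF l assms(9)]) (use e G d0 k assms(7) in simp_all)
    thus ?thesis unfolding Entp_def e_def[symmetric] by (intro SUP_least) auto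
  qed
  \<comment> \<open>The bound is independent of \<open>\<Omega>\<close> and \<open>\<delta>\<close>,
    so both increments may tend to 0 after the suprema are taken.\<close>
  have "(\<lambda>n. ereal ((d0 + inverse (real (Suc n))) * (real k * ln (G + inverse (real (Suc n))))))
      \<longlonglongrightarrow> ereal ((d0 + 0) * (real k * ln (G + 0)))"
    using G(2) by (intro tendsto_ereal tendsto_intros LIMSEQ_inverse_real_of_nat) auto
  hence "Entp \<phi> \<le> ereal ((d0 + 0) * (real k * ln (G + 0)))"
    by (rule tendsto_lowerbound) (simp_all add: * del: of_nat_Suc)
  thus ?thesis by (simp add: d0 h mult_ac)
qed

end
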